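(* Let $\Phi=(G,\mathbb{T},\varphi)$ be a complex unit gain graph whose underlying graph $G$ is connected. Then $$2\max_{V_0} m(G-V_0)\le r(G,\varphi)\le 2m(G)+b(G),$$ where the maximum is taken over all proper subsets $V_0$ of $V(G)$ such that $G-V_0$ is acyclic, and $b(G)$ is the minimum of $|S|$ over subsets $S\subset V(G)$ such that $G-S$ is bipartite.
   Context: $G=(V,E)$ is a simple graph with $V=\{v_1,\dots,v_n\}$; $e_{i,j}$ denotes the ordered pair $(v_i,v_j)$ for $v_iv_j\in E$, and $\overrightarrow{E}=\{e_{i,j},e_{j,i}: v_iv_j\in E\}$. $\mathbb{T}=\{z\in\mathbb{C}:|z|=1\}$. A complex unit gain graph $(G,\varphi)$ is $G$ together with a map $\varphi:\overrightarrow{E}\to\mathbb{T}$ with $\varphi(e_{i,j})=\varphi(e_{j,i})^{-1}$. Its adjacency matrix is the $n\times n$ Hermitian matrix $H(G,\varphi)=(a_{i,j})$ with $a_{i,j}=\varphi(e_{i,j})$ if $v_iv_j\in E$ and $a_{i,j}=0$ otherwise; $r(G,\varphi)$ is the rank of $H(G,\varphi)$. $m(G)$ is the matching number of $G$. $G-S$ denotes the subgraph induced by $V\setminus S$. *)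

theory Defs
  imports
    Complex_Main
    "Graph_Theory.Digraph_Component"
    "Jordan_Normal_Form.DL_Rank"
begin

text \<open>
  A finite simple graph is a \<^locale>\<open>pair_graph\<close>: a finite, loop-free, symmetric digraph
  without parallel arcs. Its arc set consists of both orientations of every edge.
\<close>

definition edges :: "('a, 'b) pre_digraph \<Rightarrow> 'a set set" where
  "edges G = {{u, v} | u v. (u, v) \<in> arcs_ends G}"

definition matching :: "('a, 'b) pre_digraph \<Rightarrow> 'a set set \<Rightarrow> bool" where
  "matching G M \<longleftrightarrow> M \<subseteq> edges G \<and> (\<forall>e \<in> M. \<forall>f \<in> M. e \<noteq> f \<longrightarrow> e \<inter> f = {})"

definition matching_number :: "('a, 'b) pre_digraph \<Rightarrow> nat" where
  "matching_number G = Max (card ` {M. matching G M})"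

definition delete_verts :: "('a, 'b) pre_digraph \<Rightarrow> 'a set \<Rightarrow> ('a, 'b) pre_digraph" where
  "delete_verts G S = G \<restriction> (verts G - S)"

text \<open>
  In a symmetric digraph the two orientations of one edge form a directed cycle of length 2
  (so \<^const>\<open>forest\<close> would only hold for edgeless graphs). The cycles of the underlying simple
  graph are the directed cycles of length at least 3.
\<close>

definition acyclic_graph :: "('a, 'b) pre_digraph \<Rightarrow> bool" where
  "acyclic_graph G \<longleftrightarrow> \<not> (\<exists>p. pre_digraph.cycle G p \<and> length p \<ge> 3)"

definition bipartite :: "('a, 'b) pre_digraph \<Rightarrow> bool" where
  "bipartite G \<longleftrightarrow> (\<exists>X Y. X \<union> Y = verts G \<and> X \<inter> Y = {} \<and>
     (\<forall>(u, v) \<in> arcs_ends G. (u \<in> X \<and> v \<in> Y) \<or> (u \<in> Y \<and> v \<in> X)))"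

text \<open>Deleting all vertices is allowed, and the graph without vertices is bipartite.\<close>

definition bipartite_deletion_number :: "('a, 'b) pre_digraph \<Rightarrow> nat" where
  "bipartite_deletion_number G =
     Min (card ` {S. S \<subseteq> verts G \<and> bipartite (delete_verts G S)})"

locale complex_unit_gain_graph = pair_graph G
  for G :: "'a pair_pre_digraph" +
  fixes \<phi> :: "'a \<times> 'a \<Rightarrow> complex"
  assumes gain_unit: "e \<in> parcs G \<Longrightarrow> cmod (\<phi> e) = 1"
    and gain_inverse: "(u, v) \<in> parcs G \<Longrightarrow> \<phi> (u, v) = inverse (\<phi> (v, u))"

text \<open>The list \<open>vs\<close> is the enumeration of the vertices that indexes rows and columns.\<close>

definition gain_adjacency_matrix ::
    "'a pair_pre_digraph \<Rightarrow> ('a \<times> 'a \<Rightarrow> complex) \<Rightarrow> 'a list \<Rightarrow> complex mat" where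
  "gain_adjacency_matrix G \<phi> vs = mat (length vs) (length vs)
     (\<lambda>(i, j). if (vs ! i, vs ! j) \<in> parcs G then \<phi> (vs ! i, vs ! j) else 0)"

definition gain_rank :: "'a pair_pre_digraph \<Rightarrow> ('a \<times> 'a \<Rightarrow> complex) \<Rightarrow> 'a list \<Rightarrow> nat" where
  "gain_rank G \<phi> vs = vec_space.rank (length vs) (gain_adjacency_matrix G \<phi> vs)"

end

theory Submission
  imports Defs
begin

text \<open>
  Lower bound: a leaf argument shows that the adjacency matrix of a forest with a perfect matching
  is nonsingular; apply this to the vertices covered by a maximum matching of \<open>G - V\<^sub>0\<close>.

  Upper bound: if the rank is \<open>k\<close>, a nonzero term in a determinant yields an injection \<open>\<sigma>\<close> on a set
  of \<open>k\<close> vertices with \<open>v \<sim> \<sigma> v\<close>. Let \<open>G - S\<close> be bipartite with classes \<open>X\<close> and \<open>Y\<close>. At most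
  \<open>card S\<close> of the edges \<open>{v, \<sigma> v}\<close> start in \<open>S\<close>; those that start in \<open>X\<close> end outside \<open>X\<close> and
  hence form a matching, and so do those that start in \<open>Y\<close>.
\<close>

section \<open>Rank of a matrix: independent columns and term rank\<close>

text \<open>\<open>ker\<close> says that the submatrix with rows \<open>I\<close> and columns
  \<open>J\<close> has trivial kernel. A linear relation between the full columns in
  \<open>J\<close> restricts to the rows in \<open>I\<close>, so these columns are
  independent.\<close>

lemma (in vec_space) card_le_rank_if_nonsingular:
  assumes A: "A \<in> carrier_mat n nc" and I: "I \<subseteq> {..<n}" and J: "J \<subseteq> {..<nc}"
    and ker: "\<And>x j. (\<And>i. i \<in> I \<Longrightarrow> (\<Sum>j\<in>J. A $$ (i, j) * x j) = 0) \<Longrightarrow> j \<in> J \<Longrightarrow> x j = 0"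
  shows "card J \<le> rank A"
proof -
  have fin: "finite J" using J finite_subset by blast
  have entry: "col A j $ i = A $$ (i, j)" if "i < n" "j < nc" for i j
    using that A by auto
  have inj: "inj_on (col A) J"
  proof (rule inj_onI, rule ccontr)
    fix j k assume jk: "j \<in> J" "k \<in> J" "col A j = col A k" "j \<noteq> k"
    \<comment> \<open>Two equal columns would put a difference of unit vectors into the kernel.
      Injectivity is needed because independence concerns the set of columns.\<close>
    define x :: "nat \<Rightarrow> 'a" where "x = (\<lambda>l. if l = j then 1 else if l = k then -1 else 0)"
    have "(\<Sum>l\<in>J. A $$ (i, l) * x l) = 0" if "i \<in> I" for i
    proof -
      have "(\<Sum>l\<in>J. A $$ (i, l) * x l) = (\<Sum>l\<in>{j, k}. A $$ (i, l) * x l)"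
        by (rule sum.mono_neutral_right) (use jk fin in \<open>auto simp: x_def\<close>)
      also have "\<dots> = A $$ (i, j) - A $$ (i, k)" using jk(4) by (simp add: x_def)
      also have "\<dots> = 0" using entry[of i j] entry[of i k] that I J jk by (auto simp: subset_iff)
      finally show ?thesis .
    qed
    from ker[OF this jk(1)] show False by (simp add: x_def)
  qed
  have U: "col A ` J \<subseteq> set (cols A)" using J A by (auto simp: cols_def)
  have carr: "col A ` J \<subseteq> carrier_vec n" using A by auto
  have "lin_indpt (col A ` J)"
  proof (rule finite_lin_indpt2)
    fix a assume a: "lincomb a (col A ` J) = 0\<^sub>v n"
    have "(\<Sum>j\<in>J. A $$ (i, j) * a (col A j)) = 0" if i: "i \<in> I" for i
    proof -
      have i': "i < n" using i I by auto
      have "0 = lincomb a (col A ` J) $ i" using a i' by simp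
      also have "\<dots> = (\<Sum>v\<in>col A ` J. a v * v $ i)" by (rule lincomb_index[OF i' carr])
      also have "\<dots> = (\<Sum>j\<in>J. a (col A j) * col A j $ i)" by (simp add: sum.reindex[OF inj])
      also have "\<dots> = (\<Sum>j\<in>J. A $$ (i, j) * a (col A j))"
        by (rule sum.cong) (use J i' entry in \<open>auto simp: mult.commute\<close>)
      finally show ?thesis by simp
    qed
    from ker[OF this] show "\<forall>v\<in>col A ` J. a v = 0" by auto
  qed (use fin carr in auto)
  from rank_ge_card_indpt[OF A U this] show ?thesis by (simp add: card_image[OF inj])
qed

text \<open>With the unit vectors adjoined, \<open>S\<close> lies in a finite spanning set; a
  maximal independent subset of it above \<open>S\<close> is a basis.\<close>

lemma (in vec_space) lin_indpt_extend_to_basis: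
  assumes S: "S \<subseteq> carrier_vec n" and fin: "finite S" and li: "lin_indpt S"
  obtains T where "S \<subseteq> T" "T \<subseteq> carrier_vec n" "finite T" "lin_indpt T" "card T = n"
proof -
  let ?U = "S \<union> set (unit_vecs n)"
  have U: "?U \<subseteq> carrier_vec n" using S unit_vecs_carrier by auto
  obtain T where T: "finite T" "maximal T (\<lambda>T. T \<subseteq> ?U \<and> lin_indpt T)" "S \<subseteq> T"
    using maximal_exists_superset[of ?U "\<lambda>T. T \<subseteq> ?U \<and> lin_indpt T" S] fin li by auto
  have sub: "T \<subseteq> ?U" "lin_indpt T" using T(2) by (auto simp: maximal_def)
  have "span ?U = carrier_vec n"
    using span_is_monotone[of "set (unit_vecs n)" ?U] span_unit_vecs_is_carrier
      span_closed[OF U] by auto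
  then have "card T = dim"
    using dim_span[OF U _ T(2)] fin by (simp add: module_vec_def)
  with T sub U show ?thesis by (intro that[of T]) (auto simp: dim_is_n)
qed

text \<open>Completing a maximal independent set of columns gives an invertible matrix
  \<open>B\<close>. A nonzero term of its determinant picks a nonzero entry in each column, all in
  distinct rows; only the columns taken from \<open>A\<close> are kept.\<close>

lemma (in vec_space) rank_le_term_rank:
  assumes A: "A \<in> carrier_mat n nc"
  obtains J \<sigma> where "J \<subseteq> {..<nc}" "card J = rank A" "inj_on \<sigma> J"
    "\<And>j. j \<in> J \<Longrightarrow> \<sigma> j < n \<and> A $$ (\<sigma> j, j) \<noteq> 0"
proof -
  have fin: "finite (set (cols A))" by simp
  obtain S where S: "maximal S (\<lambda>T. T \<subseteq> set (cols A) \<and> lin_indpt T)"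
    using maximal_exists_superset[of "set (cols A)" "\<lambda>T. T \<subseteq> set (cols A) \<and> lin_indpt T" "{}"]
      finite_lin_indpt2[of "{}"] by auto
  have sub: "S \<subseteq> set (cols A)" "lin_indpt S" using S by (auto simp: maximal_def)
  have carr: "S \<subseteq> carrier_vec n" using sub A cols_dim by blast
  have finS: "finite S" using sub fin finite_subset by blast
  obtain T where T: "S \<subseteq> T" "T \<subseteq> carrier_vec n" "finite T" "lin_indpt T" "card T = n"
    using lin_indpt_extend_to_basis[OF carr finS sub(2)] .
  obtain ts where ts: "set ts = T" "distinct ts" using finite_distinct_list[OF T(3)] by blast
  have len: "length ts = n" using distinct_card[OF ts(2)] ts T by simp
  define B where "B = mat_of_cols n ts"
  have B: "B \<in> carrier_mat n n" unfolding B_def using len by auto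
  have colsB: "cols B = ts" unfolding B_def using ts T by (intro cols_mat_of_cols) auto
  have "rank B = n" using lin_indpt_full_rank[OF B] colsB ts T by simp
  \<comment> \<open>Transposing makes the permutation run from columns to rows: \<open>p i\<close>
    is a row where column \<open>i\<close> of \<open>B\<close> is nonzero.\<close>
  then have "det (transpose_mat B) \<noteq> 0" using det_rank_iff[OF B] det_transpose[OF B] by simp
  then obtain p where p: "p permutes {0..<n}"
    and "(\<Prod>i = 0..<n. transpose_mat B $$ (i, p i)) \<noteq> 0"
    using B by (auto simp: det_def'[of _ n] elim!: sum.not_neutral_contains_not_neutral)
  then have nz: "transpose_mat B $$ (i, p i) \<noteq> 0" if "i < n" for i using that by auto
  have pn: "p i < n" if "i < n" for i using permutes_in_image[OF p, of i] that by auto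
  have nz': "ts ! i $ p i \<noteq> 0" if "i < n" for i
    using nz[OF that] that B pn[OF that] len by (simp add: B_def mat_of_cols_index)
  have pos: "\<exists>i<n. ts ! i = v" if "v \<in> T" for v
    using that ts(1) len by (metis in_set_conv_nth)
  then obtain pos where pos: "\<And>v. v \<in> T \<Longrightarrow> pos v < n \<and> ts ! pos v = v" by metis
  \<comment> \<open>\<open>S\<close> is a set of vectors and columns of \<open>A\<close> may repeat,
    so one index \<open>c v\<close> is chosen for each \<open>v\<close> in \<open>S\<close>.\<close>
  have "\<exists>j<nc. col A j = v" if "v \<in> S" for v
  proof -
    have "v \<in> set (cols A)" using that sub(1) by blast
    then show ?thesis using A by (auto simp: cols_def)
  qed
  then obtain c where c: "\<And>v. v \<in> S \<Longrightarrow> c v < nc \<and> col A (c v) = v" by metis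
  have injc: "inj_on c S" using c by (metis inj_onI)
  show ?thesis
  proof (rule that[of "c ` S" "\<lambda>j. p (pos (col A j))"])
    show "c ` S \<subseteq> {..<nc}" using c by auto
    show "card (c ` S) = rank A" using rank_card_indpt[OF A S] card_image[OF injc] by simp
    show "inj_on (\<lambda>j. p (pos (col A j))) (c ` S)"
    proof (rule inj_onI)
      fix j k assume jk: "j \<in> c ` S" "k \<in> c ` S" "p (pos (col A j)) = p (pos (col A k))"
      then obtain u v where uv: "j = c u" "k = c v" "u \<in> S" "v \<in> S" by auto
      have "pos u = pos v" using jk(3) uv c permutes_inj[OF p] by (auto dest: injD)
      then show "j = k" using pos uv T(1) by (metis subsetD)
    qed
    fix j assume "j \<in> c ` S"
    then obtain v where v: "j = c v" "v \<in> S" by auto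
    have "p (pos v) < n" "v $ p (pos v) \<noteq> 0"
      using pos[of v] v T(1) pn nz'[of "pos v"] by auto
    moreover have "v $ p (pos v) = A $$ (p (pos v), j)"
      using c[OF v(2)] v A \<open>p (pos v) < n\<close> by (metis carrier_matD index_col)
    ultimately show "p (pos (col A j)) < n \<and> A $$ (p (pos (col A j)), j) \<noteq> 0"
      using c[OF v(2)] v by simp
  qed
qed

section \<open>Walks given by vertex lists, and leaves of acyclic graphs\<close>

text \<open>Since an arc is the pair of its ends, zipping a vertex list with its own tail gives the
  arcs of the walk through it.\<close>

lemma cas_zip:
  assumes "tail H = fst" "head H = snd"
  shows "pre_digraph.cas H x (zip (x # xs) xs) (last (x # xs))"
  by (induction xs arbitrary: x) (simp_all add: pre_digraph.cas.simps assms)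

lemma awalk_verts_zip:
  assumes "tail H = fst" "head H = snd"
  shows "pre_digraph.awalk_verts H x (zip (x # xs) xs) = x # xs"
  by (induction xs arbitrary: x) (simp_all add: pre_digraph.awalk_verts.simps assms)

lemma set_zip_successively:
  "successively (\<lambda>u v. (u, v) \<in> E) (x # xs) \<Longrightarrow> set (zip (x # xs) xs) \<subseteq> E"
  by (induction xs arbitrary: x) auto

text \<open>The first vertex \<open>v\<close> of a longest path in \<open>W\<close> has all its
  neighbours in \<open>W\<close> on the path; a neighbour beyond the second vertex \<open>u\<close>
  would close a cycle of length at least 3. By \<open>deg\<close> the path does have a second
  vertex.\<close>

lemma acyclic_graph_leaf:
  fixes H :: "('a, 'a \<times> 'a) pre_digraph"
  assumes th: "tail H = fst" "head H = snd" and acyc: "acyclic_graph H"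
    and symH: "sym (arcs H)" and irr: "irrefl (arcs H)"
    and W: "finite W" "W \<noteq> {}" "W \<subseteq> verts H"
    and deg: "\<And>v. v \<in> W \<Longrightarrow> \<exists>u\<in>W. (v, u) \<in> arcs H"
  obtains v u where "v \<in> W" "u \<in> W" "(v, u) \<in> arcs H"
    "\<And>w. w \<in> W \<Longrightarrow> (v, w) \<in> arcs H \<Longrightarrow> w = u"
proof -
  define P where "P xs \<longleftrightarrow> xs \<noteq> [] \<and> distinct xs \<and> set xs \<subseteq> W
    \<and> successively (\<lambda>u v. (u, v) \<in> arcs H) xs" for xs
  obtain w0 where "w0 \<in> W" using W by auto
  then have "P [w0]" by (simp add: P_def)
  moreover have "length xs < Suc (card W)" if "P xs" for xs
    using that card_mono[OF W(1), of "set xs"] by (simp add: P_def distinct_card)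
  ultimately obtain xs where xs: "P xs" and mx: "\<And>ys. P ys \<Longrightarrow> length ys \<le> length xs"
    using ex_has_greatest_nat[of P "[w0]" length "Suc (card W)"] by (metis less_or_eq_imp_le)
  obtain v ys where v: "xs = v # ys" using xs by (cases xs) (auto simp: P_def)
  have on_path: "w \<in> set ys" if "w \<in> W" "(v, w) \<in> arcs H" for w
  proof (rule ccontr)
    assume "w \<notin> set ys"
    moreover have "w \<noteq> v" using irr that by (auto simp: irrefl_def)
    ultimately have "P (w # xs)"
      using xs that v symD[OF symH that(2)] by (auto simp: P_def)
    from mx[OF this] show False by simp
  qed
  have vW: "v \<in> W" using xs v by (auto simp: P_def)
  then obtain u zs where u: "ys = u # zs" using deg[OF vW] on_path by (cases ys) auto
  show ?thesis
  proof (rule that[of v u])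
    show "v \<in> W" "u \<in> W" "(v, u) \<in> arcs H" using xs v u by (auto simp: P_def)
    fix w assume w: "w \<in> W" "(v, w) \<in> arcs H"
    show "w = u"
    proof (rule ccontr)
      assume "w \<noteq> u"
      then have "w \<in> set zs" using on_path[OF w] u by auto
      then obtain as bs where zs: "zs = as @ w # bs" by (meson split_list)
      \<comment> \<open>The cycle runs from \<open>w\<close> through \<open>v\<close>,
        \<open>u\<close> and \<open>as\<close> back to \<open>w\<close>. It has as many arcs as
        \<open>?c\<close> has entries, hence at least 3 even if \<open>as\<close> is empty. Only
        \<open>?c\<close>, the vertex list without its first entry, must be distinct.\<close>
      let ?c = "v # u # as @ [w]"
      have path: "P (?c @ bs)" using xs v u zs by simp
      then have dist: "distinct ?c" by (simp add: P_def)
      have "successively (\<lambda>u v. (u, v) \<in> arcs H) ?c"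
        using path by (metis P_def successively_append_iff)
      then have "set (zip (w # ?c) ?c) \<subseteq> arcs H"
        using symD[OF symH w(2)] by (intro set_zip_successively) simp
      moreover have "pre_digraph.cas H w (zip (w # ?c) ?c) w"
        using cas_zip[OF th, of w ?c] by simp
      ultimately have "pre_digraph.cycle H (zip (w # ?c) ?c)"
        unfolding pre_digraph.cycle_def pre_digraph.awalk_def
        using w W(3) dist awalk_verts_zip[OF th, of w ?c] by (intro exI[of _ w]) auto
      moreover have "length (zip (w # ?c) ?c) \<ge> 3" by simp
      ultimately show False using acyc unfolding acyclic_graph_def by blast
    qed
  qed
qed

section \<open>Nonsingularity of forests with a perfect matching\<close>

lemma matching_subset: "matching H M \<Longrightarrow> N \<subseteq> M \<Longrightarrow> matching H N"
  by (simp add: matching_def subset_iff)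

text \<open>Elimination at leaves, one matching edge at a time. \<open>H\<close> stays fixed and the
  system is restricted to \<open>\<Union>M\<close>, so the induction only has to shrink
  \<open>M\<close>.\<close>

lemma forest_perfect_matching_nonsingular:
  fixes H :: "('a, 'a \<times> 'a) pre_digraph" and a :: "'a \<Rightarrow> 'a \<Rightarrow> 'b :: field"
  assumes th: "tail H = fst" "head H = snd" and acyc: "acyclic_graph H"
    and symH: "sym (arcs H)" and irr: "irrefl (arcs H)" and wf: "arcs H \<subseteq> verts H \<times> verts H"
    and a: "\<And>u v. u \<in> verts H \<Longrightarrow> v \<in> verts H \<Longrightarrow> a u v \<noteq> 0 \<longleftrightarrow> (u, v) \<in> arcs H"
    and "finite M" "matching H M"
    and "\<And>v. v \<in> \<Union>M \<Longrightarrow> (\<Sum>u\<in>\<Union>M. a v u * x u) = 0"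
    and "v \<in> \<Union>M"
  shows "x v = 0"
  using assms(8-11)
proof (induction M arbitrary: v rule: finite_psubset_induct)
  case (psubset M)
  let ?W = "\<Union>M"
  have edge: "\<exists>u v. e = {u, v} \<and> (u, v) \<in> arcs H \<and> (v, u) \<in> arcs H" if "e \<in> M" for e
  proof -
    have "e \<in> edges H" using that psubset.prems(1) by (auto simp: matching_def)
    then obtain u v where "e = {u, v}" "(u, v) \<in> arcs H"
      unfolding edges_def arcs_ends_def arc_to_ends_def by (auto simp: th)
    then show ?thesis using symD[OF symH] by blast
  qed
  have finW: "finite ?W" using edge psubset.hyps(1) by (metis finite.simps finite_Union)
  have WH: "?W \<subseteq> verts H" using edge wf by fast
  have deg: "\<exists>u\<in>?W. (v, u) \<in> arcs H" if v: "v \<in> ?W" for v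
  proof -
    obtain e where e: "e \<in> M" "v \<in> e" using v by auto
    then show ?thesis using edge[OF e(1)] by blast
  qed
  obtain l u where l: "l \<in> ?W" "u \<in> ?W" "(l, u) \<in> arcs H"
    and uniq: "\<And>w. w \<in> ?W \<Longrightarrow> (l, w) \<in> arcs H \<Longrightarrow> w = u"
    using acyclic_graph_leaf[OF th acyc symH irr finW _ WH deg] psubset.prems(3) by blast
  have lu: "l \<noteq> u" using l irr by (auto simp: irrefl_def)
  \<comment> \<open>The leaf \<open>l\<close> is covered by \<open>M\<close>, and its partner is a
    neighbour in \<open>?W\<close>, so it must be \<open>u\<close>.\<close>
  obtain e where e: "e \<in> M" "l \<in> e" using l by auto
  then obtain w where "e = {l, w}" "(l, w) \<in> arcs H" using edge[OF e(1)] by auto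
  then have elu: "e = {l, u}" using uniq[of w] e by auto
  have disj: "f \<inter> e = {}" if "f \<in> M - {e}" for f
    using that e psubset.prems(1) by (auto simp: matching_def)
  then have W': "\<Union>(M - {e}) = ?W - {l, u}" using elu by blast
  have sumW: "(\<Sum>t\<in>?W. a w t * x t) = a w l * x l + a w u * x u
      + (\<Sum>t\<in>\<Union>(M - {e}). a w t * x t)" for w
  proof -
    have "?W = insert l (insert u (?W - {l, u}))" using l by auto
    then have "(\<Sum>t\<in>?W. a w t * x t)
        = (\<Sum>t\<in>insert l (insert u (?W - {l, u})). a w t * x t)" by simp
    also have "\<dots> = a w l * x l + (a w u * x u + (\<Sum>t\<in>?W - {l, u}. a w t * x t))"
      using finW lu by (subst sum.insert, simp, simp, subst sum.insert) auto
    finally show ?thesis by (simp add: W' add.assoc)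
  qed
  \<comment> \<open>The zero pattern is symmetric, so both row and column \<open>l\<close> vanish on
    \<open>?W\<close> except at \<open>u\<close>.\<close>
  have al: "a l t = 0" "a t l = 0" if "t \<in> ?W" "t \<noteq> u" for t
    using a[of l t] a[of t l] uniq[OF that(1)] that(2) symD[OF symH, of t l] WH l(1) that by auto
  \<comment> \<open>Row \<open>l\<close> isolates \<open>x u\<close>.\<close>
  have "a l u * x u = 0"
    using psubset.prems(2)[OF l(1)] al(1) l(1) lu W' sumW[of l] by (simp add: sum.neutral)
  then have xu: "x u = 0" using a[of l u] l WH by auto
  \<comment> \<open>As \<open>x u = 0\<close> and column \<open>l\<close> vanishes in these rows,
    they form the system for \<open>M - {e}\<close>.\<close>
  have IH: "x t = 0" if t: "t \<in> \<Union>(M - {e})" for t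
  proof (rule psubset.IH[OF _ _ _ t])
    show "M - {e} \<subset> M" using e by auto
    show "matching H (M - {e})" using matching_subset[OF psubset.prems(1)] by auto
    fix w assume "w \<in> \<Union>(M - {e})"
    then have w: "w \<in> ?W" "w \<noteq> l" "w \<noteq> u" using W' by auto
    show "(\<Sum>t\<in>\<Union>(M - {e}). a w t * x t) = 0"
      using psubset.prems(2)[OF w(1)] al(2)[OF w(1,3)] xu sumW[of w] by simp
  qed
  \<comment> \<open>In row \<open>u\<close> only the term of \<open>x l\<close> is left.\<close>
  have "a u l * x l = 0"
    using psubset.prems(2)[OF l(2)] IH xu sumW[of u] by (simp add: sum.neutral)
  then have "x l = 0" using a[of u l] l WH symD[OF symH l(3)] by auto
  then show "x v = 0" using IH xu psubset.prems(3) W' by blast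
qed

section \<open>Matchings and the matching number\<close>

lemma finite_matchings: "finite (arcs H) \<Longrightarrow> finite {M. matching H M}"
proof -
  assume "finite (arcs H)"
  then have "finite (arcs_ends H)" by (simp add: arcs_ends_def)
  then have "finite ((\<lambda>(u, v). {u, v}) ` arcs_ends H)" by simp
  moreover have "edges H \<subseteq> (\<lambda>(u, v). {u, v}) ` arcs_ends H" by (auto simp: edges_def)
  ultimately have "finite (Pow (edges H))" using finite_subset by auto
  then show ?thesis by (rule rev_finite_subset) (auto simp: matching_def)
qed

lemma card_le_matching_number:
  "finite (arcs H) \<Longrightarrow> matching H M \<Longrightarrow> card M \<le> matching_number H"
  unfolding matching_number_def by (intro Max_ge) (auto simp: finite_matchings)

lemma maximum_matching_exists:
  assumes "finite (arcs H)"
  obtains M where "matching H M" "card M = matching_number H" "finite M"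
proof -
  have "matching H {}" by (simp add: matching_def)
  then have "matching_number H \<in> card ` {M. matching H M}"
    unfolding matching_number_def using assms by (intro Max_in) (auto simp: finite_matchings)
  then obtain M where M: "matching H M" "card M = matching_number H" by auto
  show ?thesis
  proof (cases "finite M")
    \<comment> \<open>An infinite set has \<open>card\<close> 0, so the matching number would be 0
      and the empty matching attains it.\<close>
    case False
    then show ?thesis using that[of "{}"] M \<open>matching H {}\<close> by simp
  qed (use that M in auto)
qed

text \<open>Distinct edges \<open>{v, \<sigma> v}\<close> cannot meet: their starts differ, their
  ends differ by injectivity, and \<open>X\<close> separates starts from ends.\<close>

lemma card_le_matching_number_if_injection:
  assumes fin: "finite (arcs H)" and inj: "inj_on \<sigma> R"
    and R: "R \<subseteq> X" "\<sigma> ` R \<inter> X = {}" and arc: "\<And>v. v \<in> R \<Longrightarrow> (v, \<sigma> v) \<in> arcs_ends H"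
  shows "card R \<le> matching_number H"
proof -
  have "inj_on (\<lambda>v. {v, \<sigma> v}) R" using R by (fastforce simp: inj_on_def doubleton_eq_iff)
  then have "card R = card ((\<lambda>v. {v, \<sigma> v}) ` R)" by (simp add: card_image)
  also have "\<dots> \<le> matching_number H"
  proof (rule card_le_matching_number[OF fin])
    have disj: "{v, \<sigma> v} \<inter> {w, \<sigma> w} = {}" if "v \<in> R" "w \<in> R" "v \<noteq> w" for v w
      using that R inj by (auto simp: inj_on_def)
    show "matching H ((\<lambda>v. {v, \<sigma> v}) ` R)"
      unfolding matching_def
    proof (intro conjI ballI impI)
      show "(\<lambda>v. {v, \<sigma> v}) ` R \<subseteq> edges H" using arc by (auto simp: edges_def)
      fix e f assume "e \<in> (\<lambda>v. {v, \<sigma> v}) ` R" "f \<in> (\<lambda>v. {v, \<sigma> v}) ` R" "e \<noteq> f"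
      then obtain v w where vw: "e = {v, \<sigma> v}" "f = {w, \<sigma> w}" "v \<in> R" "w \<in> R"
        by (elim imageE)
      with \<open>e \<noteq> f\<close> have "v \<noteq> w" by auto
      then show "e \<inter> f = {}" unfolding vw(1,2) by (rule disj[OF vw(3,4)])
    qed
  qed
  finally show ?thesis .
qed

section \<open>Vertex deletion, covered vertices and bipartite classes\<close>

context pair_graph
begin

lemma delete_verts_simps:
  "verts (delete_verts (with_proj G) S) = pverts G - S"
  "arcs (delete_verts (with_proj G) S) = {(u, v) \<in> parcs G. u \<notin> S \<and> v \<notin> S}"
  "tail (delete_verts (with_proj G) S) = fst"
  "head (delete_verts (with_proj G) S) = snd"
  "arcs_ends (delete_verts (with_proj G) S) = {(u, v) \<in> parcs G. u \<notin> S \<and> v \<notin> S}"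
  by (auto simp: delete_verts_def arcs_ends_conv dest: in_arcsD1 in_arcsD2)

lemma sym_parcs: "sym (parcs G)"
  using pair_sym_arcs by (simp add: symmetric_def)

text \<open>Gives the order of the principal submatrix carried by the matched vertices; an edge has
  two ends since there are no loops.\<close>

lemma card_Union_matching:
  assumes fin: "finite M" and M: "matching (delete_verts (with_proj G) S) M"
  shows "card (\<Union>M) = 2 * card M"
proof -
  have c2: "card e = 2" if e: "e \<in> M" for e
  proof -
    obtain u v where "e = {u, v}" "(u, v) \<in> parcs G"
      using e M by (auto simp: matching_def edges_def delete_verts_simps)
    then show ?thesis using pair_no_loops[of "(u, v)"] by auto
  qed
  have "card (\<Union>M) = (\<Sum>e\<in>M. card e)"
    using c2 M by (intro card_Union_disjoint)
      (auto simp: matching_def pairwise_def disjnt_def intro: card_ge_0_finite)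
  then show ?thesis using c2 by simp
qed

lemma matching_covers_verts:
  assumes "matching (delete_verts (with_proj G) S) M"
  shows "\<Union>M \<subseteq> pverts G - S"
proof
  fix v assume "v \<in> \<Union>M"
  then obtain e where e: "e \<in> M" "v \<in> e" by auto
  then obtain x y where "e = {x, y}" "(x, y) \<in> parcs G" "x \<notin> S" "y \<notin> S"
    using assms by (auto simp: matching_def edges_def delete_verts_simps)
  then show "v \<in> pverts G - S" using e in_arcsD1[of x y] in_arcsD2[of x y] by auto
qed

text \<open>\<open>R\<close> splits along \<open>X\<close>, \<open>Y\<close> and \<open>S\<close>.
  An edge starting in a class may end in \<open>S\<close>: it leaves its class all the same, so only
  the vertices of \<open>R\<close> inside \<open>S\<close> need a separate count.\<close>

lemma card_injection_le:
  assumes S: "S \<subseteq> pverts G" and bip: "bipartite (delete_verts (with_proj G) S)"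
    and R: "R \<subseteq> pverts G" and inj: "inj_on \<sigma> R" and arc: "\<And>v. v \<in> R \<Longrightarrow> (v, \<sigma> v) \<in> parcs G"
  shows "card R \<le> 2 * matching_number (with_proj G) + card S"
proof -
  obtain X Y where XY: "X \<union> Y = pverts G - S" "X \<inter> Y = {}"
    and cross: "\<And>u v. (u, v) \<in> parcs G \<Longrightarrow> u \<notin> S \<Longrightarrow> v \<notin> S \<Longrightarrow> (u \<in> X \<and> v \<in> Y) \<or> (u \<in> Y \<and> v \<in> X)"
    using bip by (auto simp: bipartite_def delete_verts_simps)
  have finS: "finite S" using S pair_finite_verts finite_subset by blast
  have part: "card (R \<inter> Z) \<le> matching_number (with_proj G)" if Z: "Z = X \<or> Z = Y" for Z
  proof (rule card_le_matching_number_if_injection)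
    show "finite (arcs (with_proj G))" using pair_finite_arcs by simp
    show "inj_on \<sigma> (R \<inter> Z)" using inj by (rule inj_on_subset) auto
    show "\<sigma> ` (R \<inter> Z) \<inter> Z = {}"
    proof (rule equals0I)
      \<comment> \<open>An arc staying inside the class \<open>Z\<close> has both ends outside
        \<open>S\<close>, against bipartiteness.\<close>
      fix w assume "w \<in> \<sigma> ` (R \<inter> Z) \<inter> Z"
      then obtain v where v: "w = \<sigma> v" "v \<in> R" "v \<in> Z" "w \<in> Z" by auto
      then have "v \<notin> S" "w \<notin> S" using Z XY by auto
      from cross[OF _ this] arc[OF v(2)] v Z XY(2) show False by auto
    qed
  qed (use arc in auto)
  have "R = (R \<inter> X) \<union> (R \<inter> Y) \<union> (R \<inter> S)" using R XY by auto
  then have "card R \<le> card (R \<inter> X) + card (R \<inter> Y) + card (R \<inter> S)"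
    by (metis (no_types, lifting) add_mono card_Un_le order_refl order_trans)
  also have "\<dots> \<le> matching_number (with_proj G) + matching_number (with_proj G) + card S"
    using part card_mono[OF finS, of "R \<inter> S"] by (intro add_mono) auto
  finally show ?thesis by simp
qed

end

section \<open>Rank bounds for gain graphs\<close>

context complex_unit_gain_graph
begin

lemma gain_nonzero: "e \<in> parcs G \<Longrightarrow> \<phi> e \<noteq> 0"
  using gain_unit[of e] by auto

text \<open>The vertices covered by a maximum matching of the forest index a nonsingular principal
  submatrix.\<close>

lemma gain_rank_ge:
  assumes vs: "distinct vs" "set vs = pverts G"
    and acyc: "acyclic_graph (delete_verts (with_proj G) S)"
  shows "2 * matching_number (delete_verts (with_proj G) S) \<le> gain_rank G \<phi> vs"
proof -
  let ?H = "delete_verts (with_proj G) S" and ?A = "gain_adjacency_matrix G \<phi> vs"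
  \<comment> \<open>The matrix indexed by vertices, built from all of \<open>G\<close>. Deletion
    leaves an induced subgraph, so on the remaining vertices its zero pattern is that of
    \<open>?H\<close>.\<close>
  define a where "a u v = (if (u, v) \<in> parcs G then \<phi> (u, v) else 0)" for u v
  interpret vec_space "TYPE(complex)" "length vs" .
  have "finite (arcs ?H)"
    using pair_finite_arcs by (rule rev_finite_subset) (auto simp: delete_verts_simps)
  then obtain M where M: "matching ?H M" "card M = matching_number ?H" "finite M"
    by (rule maximum_matching_exists)
  let ?J = "{i. i < length vs \<and> vs ! i \<in> \<Union>M}"
  have sub: "\<Union>M \<subseteq> set vs" using matching_covers_verts[OF M(1)] vs by auto
  have bij: "bij_betw ((!) vs) ?J (\<Union>M)"
    unfolding bij_betw_def
  proof
    show "inj_on ((!) vs) ?J" using vs by (auto simp: inj_on_def nth_eq_iff_index_eq)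
    have "v \<in> (!) vs ` ?J" if "v \<in> \<Union>M" for v
      using that sub in_set_conv_nth[of v vs] by auto
    then show "(!) vs ` ?J = \<Union>M" by auto
  qed
  have "card ?J \<le> rank ?A"
  proof (rule card_le_rank_if_nonsingular)
    show "?A \<in> carrier_mat (length vs) (length vs)" by (simp add: gain_adjacency_matrix_def)
    fix x :: "nat \<Rightarrow> complex" and j
    assume ker: "\<And>i. i \<in> ?J \<Longrightarrow> (\<Sum>j\<in>?J. ?A $$ (i, j) * x j) = 0" and j: "j \<in> ?J"
    \<comment> \<open>A kernel vector on indices is carried over to the matched vertices along the
      enumeration.\<close>
    define y where "y = x \<circ> the_inv_into ?J ((!) vs)"
    have y: "y (vs ! j) = x j" if "j \<in> ?J" for j
      unfolding y_def using that bij by (simp add: bij_betw_def the_inv_into_f_f)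
    have "y (vs ! j) = 0"
    proof (rule forest_perfect_matching_nonsingular[OF _ _ acyc _ _ _ _ M(3) M(1)])
      show "sym (arcs ?H)" using sym_parcs by (auto simp: delete_verts_simps sym_def)
      show "irrefl (arcs ?H)" using pair_no_loops by (fastforce simp: delete_verts_simps irrefl_def)
      show "arcs ?H \<subseteq> verts ?H \<times> verts ?H"
        by (auto simp: delete_verts_simps dest: in_arcsD1 in_arcsD2)
      show "a u v \<noteq> 0 \<longleftrightarrow> (u, v) \<in> arcs ?H" if "u \<in> verts ?H" "v \<in> verts ?H" for u v
        using that gain_nonzero by (auto simp: a_def delete_verts_simps)
      show "vs ! j \<in> \<Union>M" using j by simp
      fix v assume "v \<in> \<Union>M"
      then obtain i where i: "i \<in> ?J" "v = vs ! i" using bij_betw_imp_surj_on[OF bij] by blast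
      have "(\<Sum>u\<in>\<Union>M. a v u * y u) = (\<Sum>j\<in>?J. a v (vs ! j) * y (vs ! j))"
        by (rule sum.reindex_bij_betw[OF bij, symmetric])
      also have "\<dots> = (\<Sum>j\<in>?J. ?A $$ (i, j) * x j)"
        using i y by (intro sum.cong) (auto simp: gain_adjacency_matrix_def a_def)
      finally show "(\<Sum>u\<in>\<Union>M. a v u * y u) = 0" using ker[OF i(1)] by simp
    qed (simp_all add: delete_verts_simps)
    then show "x j = 0" using y[OF j] by simp
  qed auto
  then show ?thesis
    using bij_betw_same_card[OF bij] card_Union_matching[OF M(3,1)] M(2) by (simp add: gain_rank_def)
qed

text \<open>Nonzero entries are arcs, so the term rank yields an injection along arcs, which
  \<open>card_injection_le\<close> bounds.\<close>

lemma gain_rank_le: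
  assumes vs: "distinct vs" "set vs = pverts G"
    and S: "S \<subseteq> pverts G" "bipartite (delete_verts (with_proj G) S)"
  shows "gain_rank G \<phi> vs \<le> 2 * matching_number (with_proj G) + card S"
proof -
  let ?A = "gain_adjacency_matrix G \<phi> vs"
  interpret vec_space "TYPE(complex)" "length vs" .
  have "?A \<in> carrier_mat (length vs) (length vs)" by (simp add: gain_adjacency_matrix_def)
  then obtain J \<sigma> where J: "J \<subseteq> {..<length vs}" "card J = rank ?A" and inj: "inj_on \<sigma> J"
    and nz: "\<And>j. j \<in> J \<Longrightarrow> \<sigma> j < length vs \<and> ?A $$ (\<sigma> j, j) \<noteq> 0"
    using rank_le_term_rank by metis
  have injvs: "inj_on ((!) vs) {..<length vs}"
    using vs by (auto simp: inj_on_def nth_eq_iff_index_eq)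
  have injJ: "inj_on ((!) vs) J" using injvs J(1) by (rule inj_on_subset)
  define i where "i = the_inv_into J ((!) vs)"
  have i: "i (vs ! j) = j" if "j \<in> J" for j
    unfolding i_def using injJ that by (rule the_inv_into_f_f)
  \<comment> \<open>\<open>\<sigma>\<close> leads from columns to rows, so the nonzero entry gives
    the arc towards \<open>vs ! j\<close>; symmetry reverses it.\<close>
  have arc: "(vs ! j, vs ! \<sigma> j) \<in> parcs G" if "j \<in> J" for j
    using nz[OF that] that J(1) symD[OF sym_parcs]
    by (auto simp: gain_adjacency_matrix_def split: if_splits)
  have "card ((!) vs ` J) \<le> 2 * matching_number (with_proj G) + card S"
  proof (rule card_injection_le[OF S, where \<sigma> = "\<lambda>v. vs ! \<sigma> (i v)"])
    show "(!) vs ` J \<subseteq> pverts G" using J(1) by (auto simp flip: vs(2))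
    show "inj_on (\<lambda>v. vs ! \<sigma> (i v)) ((!) vs ` J)"
    proof (rule inj_onI, clarify)
      fix j k assume jk: "j \<in> J" "k \<in> J" "vs ! \<sigma> (i (vs ! j)) = vs ! \<sigma> (i (vs ! k))"
      then have "\<sigma> j = \<sigma> k" using nz vs by (simp add: i nth_eq_iff_index_eq)
      then show "vs ! j = vs ! k" using inj jk by (auto dest: inj_onD)
    qed
    fix v assume "v \<in> (!) vs ` J"
    then show "(v, vs ! \<sigma> (i v)) \<in> parcs G" using arc i by auto
  qed
  then show ?thesis using J(2) by (simp add: card_image[OF injJ] gain_rank_def)
qed

end

theorem theorem1p13:
  fixes G :: "'a pair_pre_digraph" and \<phi> :: "'a \<times> 'a \<Rightarrow> complex" and vs :: "'a list"
  assumes "complex_unit_gain_graph G \<phi>"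
    and "Digraph_Component.connected (with_proj G)"
    and "distinct vs" and "set vs = pverts G"
  shows "2 * Max {matching_number (delete_verts (with_proj G) V\<^sub>0) | V\<^sub>0.
             V\<^sub>0 \<subset> pverts G \<and> acyclic_graph (delete_verts (with_proj G) V\<^sub>0)}
           \<le> gain_rank G \<phi> vs \<and>
         gain_rank G \<phi> vs
           \<le> 2 * matching_number (with_proj G) + bipartite_deletion_number (with_proj G)"
proof
  interpret complex_unit_gain_graph G \<phi> by fact
  let ?N = "{matching_number (delete_verts (with_proj G) V\<^sub>0) | V\<^sub>0.
    V\<^sub>0 \<subset> pverts G \<and> acyclic_graph (delete_verts (with_proj G) V\<^sub>0)}"
  have "?N \<subseteq> (\<lambda>V\<^sub>0. matching_number (delete_verts (with_proj G) V\<^sub>0)) ` Pow (pverts G)" by auto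
  then have fin: "finite ?N" by (rule finite_subset) (simp add: pair_finite_verts)
  \<comment> \<open>Connectedness includes having a vertex \<open>v\<close>. Deleting all the others
    is a proper deletion that leaves no arcs, so \<open>?N\<close> is nonempty and its maximum is
    attained.\<close>
  obtain v where v: "v \<in> pverts G"
    using assms(2) by (auto simp: Digraph_Component.connected_def strongly_connected_def)
  let ?H = "delete_verts (with_proj G) (pverts G - {v})"
  have "arcs ?H = {}"
    using pair_no_loops by (fastforce simp: delete_verts_simps dest: in_arcsD1 in_arcsD2)
  then have "acyclic_graph ?H"
    by (auto simp: acyclic_graph_def pre_digraph.cycle_def pre_digraph.awalk_def)
  then have "matching_number ?H \<in> ?N" using v by blast
  then have "Max ?N \<in> ?N" using fin by (intro Max_in) auto
  then show "2 * Max ?N \<le> gain_rank G \<phi> vs" using gain_rank_ge[OF assms(3,4)] by auto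
next
  interpret complex_unit_gain_graph G \<phi> by fact
  let ?B = "{S. S \<subseteq> verts (with_proj G) \<and> bipartite (delete_verts (with_proj G) S)}"
  \<comment> \<open>Deleting every vertex is admissible, so the minimum is over a nonempty set and
    some \<open>S\<close> attains it.\<close>
  have "bipartite (delete_verts (with_proj G) (pverts G))"
    by (auto simp: bipartite_def delete_verts_simps dest: in_arcsD1)
  then have "pverts G \<in> ?B" by simp
  moreover have "finite ?B" by (simp add: pair_finite_verts)
  ultimately have "bipartite_deletion_number (with_proj G) \<in> card ` ?B"
    unfolding bipartite_deletion_number_def by (intro Min_in) auto
  then show "gain_rank G \<phi> vs
      \<le> 2 * matching_number (with_proj G) + bipartite_deletion_number (with_proj G)"
    using gain_rank_le[OF assms(3,4)] by auto
qed

end
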